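(* Let $\lambda/\mu$ be a skew partition of size $n$. For any bijective tableau $\tau$ of shape $\lambda/\mu$, $$\Sigma_L(\mathsf{poset}(\tau)) = \mathsf{read}_\tau(\mathrm{SYT}(\lambda/\mu)) := \{\mathsf{read}_\tau(T) \mid T \in \mathrm{SYT}(\lambda/\mu)\}.$$
   Context: Let $n$ be a nonnegative integer, $[n]=\{1,\dots,n\}$, and $\mathfrak S_n$ the symmetric group on $[n]$. A skew partition $\lambda/\mu$ is a pair of partitions with $\mu_i\le\lambda_i$ for all $i$ (missing parts are $0$); its Young diagram is the set of boxes $(i,j)$ (row $i$ counted from the top, column $j$ from the left) with $\mu_i<j\le\lambda_i$; its size is $|\lambda|-|\mu|$. Every skew partition is assumed basic: its Young diagram has no empty rows and no empty columns. A bijective tableau of shape $\lambda/\mu$ (of size $n$) is a filling of the Young diagram in which each element of $[n]$ appears exactly once; $T_B$ is the entry of $T$ in box $B$ and $T^{-1}(k)$ is the box containing $k$. $\mathrm{SYT}(\lambda/\mu)$ is the set of standard Young tableaux of shape $\lambda/\mu$: bijective tableaux whose rows increase from left to right and whose columns increase from top to bottom. For a bijective tableau $\tau$, $\mathsf{poset}(\tau)$ is the poset on $[n]$ with $i\preceq_\tau j$ if and only if the box of $i$ in $\tau$ is weakly above and weakly left of the box of $j$. For a poset $P$ with underlying set $[n]$ and order $\preceq_P$, $\Sigma_L(P)=\{\sigma\in\mathfrak S_n\mid \sigma(i)\le\sigma(j)\text{ for all } i\preceq_P j\}$. For bijective tableaux $\tau,T$ of shape $\lambda/\mu$, $\mathsf{read}_\tau(T)\in\mathfrak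 S_n$ is the permutation with $\mathsf{read}_\tau(T)(k)=T_{\tau^{-1}(k)}$ for $1\le k\le n$. *)

theory Defs
  imports "HOL-Combinatorics.Permutations" "HOL-Library.FuncSet"
begin

text \<open>
  A partition is the list of its (positive) parts in weakly decreasing order. Rows, columns and
  parts are numbered from 1, and missing parts are 0.
\<close>

definition is_partition :: "nat list \<Rightarrow> bool" where
  "is_partition \<nu> \<longleftrightarrow> sorted_wrt (\<ge>) \<nu> \<and> (\<forall>p \<in> set \<nu>. 0 < p)"

definition part :: "nat list \<Rightarrow> nat \<Rightarrow> nat" where
  "part \<nu> i = (if 1 \<le> i \<and> i \<le> length \<nu> then \<nu> ! (i - 1) else 0)"

text \<open>A box is a pair (row, column).\<close>

type_synonym box = "nat \<times> nat"

definition diagram :: "nat list \<Rightarrow> nat list \<Rightarrow> box set" where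
  "diagram lam mu = {(i, j). 1 \<le> i \<and> part mu i < j \<and> j \<le> part lam i}"

text \<open>
  Skew partitions are always basic: each row and each column of the Young diagram of the outer
  partition contains a box of the skew diagram.
\<close>

definition skew_partition :: "nat list \<Rightarrow> nat list \<Rightarrow> bool" where
  "skew_partition lam mu \<longleftrightarrow>
     is_partition lam \<and> is_partition mu \<and> (\<forall>i \<ge> 1. part mu i \<le> part lam i) \<and>
     (\<forall>i \<in> {1..length lam}. \<exists>j. (i, j) \<in> diagram lam mu) \<and>
     (\<forall>j \<in> {1..part lam 1}. \<exists>i. (i, j) \<in> diagram lam mu)"

definition skew_size :: "nat list \<Rightarrow> nat list \<Rightarrow> nat" where
  "skew_size lam mu = sum_list lam - sum_list mu"

text \<open>
  The subtraction above does not truncate on skew partitions, and the size is the number of boxes,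
  so fillings that are bijections onto the numbers from 1 to the size do exist.
\<close>

lemma sum_list_eq_sum_part:
  assumes "length \<nu> \<le> m"
  shows "sum_list \<nu> = (\<Sum>i = 1..m. part \<nu> i)"
proof -
  have "sum_list \<nu> = (\<Sum>i = 0..<length \<nu>. \<nu> ! i)"
    by (rule sum_list_sum_nth)
  also have "\<dots> = (\<Sum>i = 1..length \<nu>. part \<nu> i)"
    by (rule sum.reindex_bij_witness[of _ "\<lambda>i. i - 1" Suc]) (auto simp: part_def)
  also have "\<dots> = (\<Sum>i = 1..m. part \<nu> i)"
    by (rule sum.mono_neutral_left) (use assms in \<open>auto simp: part_def\<close>)
  finally show ?thesis .
qed

lemma skew_partition_size:
  assumes "skew_partition lam mu"
  shows "sum_list mu \<le> sum_list lam"
    and "finite (diagram lam mu)"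
    and "card (diagram lam mu) = skew_size lam mu"
proof -
  let ?m = "max (length lam) (length mu)"
  have le: "part mu i \<le> part lam i" if "i \<ge> 1" for i
    using assms that by (simp add: skew_partition_def)
  have D: "diagram lam mu = (SIGMA i:{1..?m}. {part mu i<..part lam i})"
    by (auto simp: diagram_def part_def split: if_splits)
  have s: "sum_list lam = (\<Sum>i = 1..?m. part lam i)" "sum_list mu = (\<Sum>i = 1..?m. part mu i)"
    by (rule sum_list_eq_sum_part, simp)+
  show "sum_list mu \<le> sum_list lam"
    unfolding s by (rule sum_mono) (simp add: le)
  show "finite (diagram lam mu)"
    unfolding D by simp
  have "card (diagram lam mu) = (\<Sum>i = 1..?m. part lam i - part mu i)"
    unfolding D by simp
  also have "\<dots> = skew_size lam mu"
    unfolding skew_size_def s by (rule sum_subtractf_nat) (simp add: le)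
  finally show "card (diagram lam mu) = skew_size lam mu" .
qed

text \<open>
  Fillings are extensional functions, i.e. undefined outside the diagram, so that a filling is
  determined by its entries.
\<close>

definition bijective_tableaux :: "nat list \<Rightarrow> nat list \<Rightarrow> (box \<Rightarrow> nat) set" where
  "bijective_tableaux lam mu =
     {T \<in> extensional (diagram lam mu). bij_betw T (diagram lam mu) {1..skew_size lam mu}}"

definition SYT :: "nat list \<Rightarrow> nat list \<Rightarrow> (box \<Rightarrow> nat) set" where
  "SYT lam mu = {T \<in> bijective_tableaux lam mu.
     (\<forall>i j j'. (i, j) \<in> diagram lam mu \<and> (i, j') \<in> diagram lam mu \<and> j < j' \<longrightarrow> T (i, j) < T (i, j')) \<and>
     (\<forall>i i' j. (i, j) \<in> diagram lam mu \<and> (i', j) \<in> diagram lam mu \<and> i < i' \<longrightarrow> T (i, j) < T (i', j))}"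

definition box_of :: "nat list \<Rightarrow> nat list \<Rightarrow> (box \<Rightarrow> nat) \<Rightarrow> nat \<Rightarrow> box" where
  "box_of lam mu T = inv_into (diagram lam mu) T"

text \<open>A poset on the numbers from 1 to n is given by its order relation, as a set of pairs.\<close>

definition tableau_poset :: "nat list \<Rightarrow> nat list \<Rightarrow> (box \<Rightarrow> nat) \<Rightarrow> nat rel" where
  "tableau_poset lam mu \<tau> =
     {(i, j). i \<in> {1..skew_size lam mu} \<and> j \<in> {1..skew_size lam mu} \<and>
        fst (box_of lam mu \<tau> i) \<le> fst (box_of lam mu \<tau> j) \<and>
        snd (box_of lam mu \<tau> i) \<le> snd (box_of lam mu \<tau> j)}"

lemma partial_order_on_tableau_poset:
  assumes "\<tau> \<in> bijective_tableaux lam mu"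
  shows "partial_order_on {1..skew_size lam mu} (tableau_poset lam mu \<tau>)"
proof -
  have inj: "inj_on (box_of lam mu \<tau>) {1..skew_size lam mu}"
    using assms unfolding box_of_def bijective_tableaux_def
    by (auto intro!: inj_on_inv_into simp: bij_betw_def)
  have "antisym (tableau_poset lam mu \<tau>)"
  proof (rule antisymI)
    fix i j
    assume "(i, j) \<in> tableau_poset lam mu \<tau>" "(j, i) \<in> tableau_poset lam mu \<tau>"
    then have "box_of lam mu \<tau> i = box_of lam mu \<tau> j" "i \<in> {1..skew_size lam mu}"
      "j \<in> {1..skew_size lam mu}"
      by (auto simp: tableau_poset_def intro: prod_eqI)
    then show "i = j"
      by (rule inj_onD[OF inj])
  qed
  moreover have "trans (tableau_poset lam mu \<tau>)"
    unfolding tableau_poset_def by (rule transI) auto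
  moreover have "refl_on {1..skew_size lam mu} (tableau_poset lam mu \<tau>)"
    by (rule refl_onI) (auto simp: tableau_poset_def)
  moreover have "tableau_poset lam mu \<tau> \<subseteq> {1..skew_size lam mu} \<times> {1..skew_size lam mu}"
    by (auto simp: tableau_poset_def)
  ultimately show ?thesis
    by (simp add: partial_order_on_def preorder_on_def)
qed

definition Sigma_L :: "nat \<Rightarrow> nat rel \<Rightarrow> (nat \<Rightarrow> nat) set" where
  "Sigma_L n P = {\<sigma>. \<sigma> permutes {1..n} \<and> (\<forall>(i, j) \<in> P. \<sigma> i \<le> \<sigma> j)}"

text \<open>
  As usual for \<^const>\<open>permutes\<close>, a permutation of the numbers from 1 to n is extended by the identity.
\<close>

definition tableau_read :: "nat list \<Rightarrow> nat list \<Rightarrow> (box \<Rightarrow> nat) \<Rightarrow> (box \<Rightarrow> nat) \<Rightarrow> nat \<Rightarrow> nat" where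
  "tableau_read lam mu \<tau> T k =
     (if k \<in> {1..skew_size lam mu} then T (box_of lam mu \<tau> k) else k)"

end

theory Submission
  imports Defs
begin

text \<open>
  Reindexing along \<open>\<tau>\<close> turns a permutation \<open>\<sigma>\<close> into the filling \<open>\<sigma> \<circ> \<tau>\<close>, and
  this is inverse to taking the reading word. Under this correspondence the linear extension
  condition says that the filling is weakly increasing for the \<^emph>\<open>product order\<close> on boxes
  (weakly above and weakly left), a condition that does not involve \<open>\<tau>\<close>; this is
  \<open>Sigma_L_tableau_poset_iff\<close>.

  Standardness only compares boxes in a common row or a common column, so the content of the
  theorem is that these comparisons generate the product order on the diagram. They do because
  a skew diagram contains the corner \<open>(i, j')\<close> of every rectangle whose upper left box
  \<open>(i, j)\<close> and lower right box \<open>(i', j')\<close> it contains (\<open>diagram_corner\<close>): one can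
  walk along the row from \<open>(i, j)\<close> to the corner and then down the column. This gives the
  description of standard tableaux in \<open>SYT_iff_mono\<close>. Passing between strict and weak
  inequalities is harmless because fillings are injective.
\<close>

lemma part_antimono:
  assumes "is_partition \<nu>" "1 \<le> i" "i \<le> i'"
  shows "part \<nu> i' \<le> part \<nu> i"
proof (cases "i = i'")
  case False
  with assms show ?thesis
    by (auto simp: is_partition_def part_def intro!: sorted_wrt_nth_less[where P = "(\<ge>)"])
qed simp

text \<open>
  The corner lies in the diagram because it is no further left than \<open>(i, j)\<close> in the same row,
  and because the row of the lower box \<open>(i', j')\<close> reaches at most as far to the right as row
  \<open>i\<close>.
\<close>

lemma diagram_corner:
  assumes "is_partition lam" "(i, j) \<in> diagram lam mu" "(i', j') \<in> diagram lam mu"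
    and "i \<le> i'" "j \<le> j'"
  shows "(i, j') \<in> diagram lam mu"
  using assms part_antimono[of lam i i'] by (auto simp: diagram_def)

lemma SYT_iff_mono:
  assumes "is_partition lam"
  shows "T \<in> SYT lam mu \<longleftrightarrow> T \<in> bijective_tableaux lam mu \<and>
    (\<forall>b \<in> diagram lam mu. \<forall>c \<in> diagram lam mu. fst b \<le> fst c \<and> snd b \<le> snd c \<longrightarrow> T b \<le> T c)"
    (is "_ \<longleftrightarrow> _ \<and> ?mono")
proof (intro iffI conjI ballI impI)
  fix b c
  assume T: "T \<in> SYT lam mu" and bc: "b \<in> diagram lam mu" "c \<in> diagram lam mu"
    and le: "fst b \<le> fst c \<and> snd b \<le> snd c"
  obtain i j i' j' where [simp]: "b = (i, j)" "c = (i', j')"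
    by (cases b, cases c)
  have corner: "(i, j') \<in> diagram lam mu"
    using diagram_corner[OF assms, of i j mu i' j'] bc le by simp
  have "T (i, j) \<le> T (i, j')"
    using T bc le corner by (cases "j = j'") (auto simp: SYT_def intro: less_imp_le)
  also have "\<dots> \<le> T (i', j')"
    using T bc le corner by (cases "i = i'") (auto simp: SYT_def intro: less_imp_le)
  finally show "T b \<le> T c"
    by simp
next
  assume "T \<in> bijective_tableaux lam mu \<and> ?mono"
  then have T: "T \<in> bijective_tableaux lam mu" and mono: ?mono
    by auto
  have strict: "T b < T c"
    if "b \<in> diagram lam mu" "c \<in> diagram lam mu" "fst b \<le> fst c" "snd b \<le> snd c" "b \<noteq> c" for b c
  proof -
    have "T b \<noteq> T c"
      using T that by (auto simp: bijective_tableaux_def bij_betw_def inj_on_def)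
    with mono that show ?thesis
      by (auto simp: le_less)
  qed
  show "T \<in> SYT lam mu"
    using T strict by (auto simp: SYT_def)
qed (simp add: SYT_def)

lemma box_of_entry:
  assumes "\<tau> \<in> bijective_tableaux lam mu" "b \<in> diagram lam mu"
  shows "box_of lam mu \<tau> (\<tau> b) = b"
  using assms by (auto simp: box_of_def bijective_tableaux_def bij_betw_def)

lemma tableau_read_entry:
  assumes "\<tau> \<in> bijective_tableaux lam mu" "b \<in> diagram lam mu"
  shows "tableau_read lam mu \<tau> T (\<tau> b) = T b"
  using assms bij_betw_apply[of \<tau> "diagram lam mu" "{1..skew_size lam mu}" b]
  by (auto simp: tableau_read_def box_of_entry bijective_tableaux_def)

text \<open>Indexing the elements of the poset by their boxes removes \<open>\<tau>\<close> from the order relation.\<close>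

lemma Sigma_L_tableau_poset_iff:
  assumes "\<tau> \<in> bijective_tableaux lam mu"
  shows "\<sigma> \<in> Sigma_L n (tableau_poset lam mu \<tau>) \<longleftrightarrow> \<sigma> permutes {1..n} \<and>
    (\<forall>b \<in> diagram lam mu. \<forall>c \<in> diagram lam mu.
       fst b \<le> fst c \<and> snd b \<le> snd c \<longrightarrow> \<sigma> (\<tau> b) \<le> \<sigma> (\<tau> c))"
proof -
  have "{1..skew_size lam mu} = \<tau> ` diagram lam mu"
    using assms by (auto simp: bijective_tableaux_def bij_betw_def)
  then have "tableau_poset lam mu \<tau> =
      {(\<tau> b, \<tau> c) |b c. b \<in> diagram lam mu \<and> c \<in> diagram lam mu \<and> fst b \<le> fst c \<and> snd b \<le> snd c}"
    using box_of_entry[OF assms] unfolding tableau_poset_def by fastforce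
  then show ?thesis
    unfolding Sigma_L_def mem_Collect_eq by (auto simp del: split_paired_Ex) fastforce
qed

lemma tableau_read_permutes:
  assumes "\<tau> \<in> bijective_tableaux lam mu" "T \<in> bijective_tableaux lam mu"
  shows "tableau_read lam mu \<tau> T permutes {1..skew_size lam mu}"
proof (rule bij_imp_permutes)
  have "bij_betw (box_of lam mu \<tau>) {1..skew_size lam mu} (diagram lam mu)"
    using assms(1) by (auto simp: box_of_def bijective_tableaux_def intro: bij_betw_inv_into)
  then have "bij_betw (T \<circ> box_of lam mu \<tau>) {1..skew_size lam mu} {1..skew_size lam mu}"
    using assms(2) by (auto simp: bijective_tableaux_def intro: bij_betw_trans)
  then show "bij_betw (tableau_read lam mu \<tau> T) {1..skew_size lam mu} {1..skew_size lam mu}"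
    by (rule bij_betw_cong[THEN iffD1, rotated]) (simp add: tableau_read_def)
qed (auto simp: tableau_read_def)

lemma permuted_tableau_bijective:
  assumes "\<tau> \<in> bijective_tableaux lam mu" "\<sigma> permutes {1..skew_size lam mu}"
  shows "restrict (\<sigma> \<circ> \<tau>) (diagram lam mu) \<in> bijective_tableaux lam mu"
  using assms bij_betw_trans[OF _ permutes_imp_bij]
  by (auto simp: bijective_tableaux_def)

lemma tableau_read_permuted_tableau:
  assumes "\<tau> \<in> bijective_tableaux lam mu" "\<sigma> permutes {1..skew_size lam mu}"
  shows "tableau_read lam mu \<tau> (restrict (\<sigma> \<circ> \<tau>) (diagram lam mu)) = \<sigma>"
proof
  fix k
  show "tableau_read lam mu \<tau> (restrict (\<sigma> \<circ> \<tau>) (diagram lam mu)) k = \<sigma> k"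
  proof (cases "k \<in> {1..skew_size lam mu}")
    case True
    then have "k \<in> \<tau> ` diagram lam mu"
      using assms(1) by (simp add: bijective_tableaux_def bij_betw_def)
    then obtain b where "b \<in> diagram lam mu" "k = \<tau> b"
      by blast
    then show ?thesis
      using tableau_read_entry[OF assms(1)] by simp
  next
    case False
    then show ?thesis
      using permutes_not_in[OF assms(2) False] by (auto simp: tableau_read_def)
  qed
qed

theorem lemma3p2:
  fixes lam mu :: "nat list" and n :: nat and \<tau> :: "box \<Rightarrow> nat"
  assumes "skew_partition lam mu"
    and "skew_size lam mu = n"
    and "\<tau> \<in> bijective_tableaux lam mu"
  shows "Sigma_L n (tableau_poset lam mu \<tau>) = {tableau_read lam mu \<tau> T |T. T \<in> SYT lam mu}"
proof (intro equalityI subsetI)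
  have lam: "is_partition lam"
    using assms(1) by (simp add: skew_partition_def)
  note Sigma_L_iff = Sigma_L_tableau_poset_iff[OF assms(3)]
  {
    fix \<sigma>
    assume \<sigma>: "\<sigma> \<in> Sigma_L n (tableau_poset lam mu \<tau>)"
    let ?T = "restrict (\<sigma> \<circ> \<tau>) (diagram lam mu)"
    have perm: "\<sigma> permutes {1..skew_size lam mu}"
      using \<sigma> assms(2) by (simp add: Sigma_L_iff)
    have "?T \<in> SYT lam mu"
      using \<sigma> permuted_tableau_bijective[OF assms(3) perm]
      by (simp add: SYT_iff_mono[OF lam] Sigma_L_iff)
    moreover have "\<sigma> = tableau_read lam mu \<tau> ?T"
      using tableau_read_permuted_tableau[OF assms(3) perm] by simp
    ultimately show "\<sigma> \<in> {tableau_read lam mu \<tau> T |T. T \<in> SYT lam mu}"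
      by blast
  next
    fix \<sigma>
    assume "\<sigma> \<in> {tableau_read lam mu \<tau> T |T. T \<in> SYT lam mu}"
    then obtain T where T: "T \<in> SYT lam mu" and \<sigma>: "\<sigma> = tableau_read lam mu \<tau> T"
      by blast
    then show "\<sigma> \<in> Sigma_L n (tableau_poset lam mu \<tau>)"
      using tableau_read_permutes[OF assms(3), of T] assms(2)
      by (simp add: SYT_iff_mono[OF lam] Sigma_L_iff tableau_read_entry[OF assms(3)])
  }
qed

end
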